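(* Let $A\in\mathbb{R}^{m\times m}$ be symmetric positive semidefinite, let $\lambda>0$, let $y\in\mathbb{R}^m$, let $\Omega\in\mathbb{R}^{m\times n_\Omega}$, and let $k\ge1$ be an integer with $k(n_\Omega+1)\le m$. Let $W_k$ be a matrix whose columns form an orthonormal basis of $\mathcal{K}_k(A,\Omega)$ and $T_k=W_k^{\top}AW_k$, and let $\widehat{W}_k$ be a matrix whose columns form an orthonormal basis of the augmented Krylov subspace $\mathcal{K}_k(A,[y,\Omega])$ and $\widehat{T}_k=\widehat{W}_k^{\top}A\widehat{W}_k$. Then $$\operatorname{Tr}(\log(\lambda I+W_kT_kW_k^{\top})) \le \operatorname{Tr}(\log(\lambda I+\widehat{W}_k\widehat{T}_k\widehat{W}_k^{\top})) \le \operatorname{Tr}(\log(\lambda I+A)).$$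
   Context: For a matrix $Z$ with $m$ rows, $\mathcal{K}_k(A,Z)$ denotes the block Krylov subspace, i.e. the span of all columns of $Z, AZ, \dots, A^{k-1}Z$; thus $\mathcal{K}_k(A,[y,\Omega])=\mathcal{K}_k(A,y)+\mathcal{K}_k(A,\Omega)$. Standing assumption: the block size of the block Lanczos method used to compute the bases remains constant, i.e. the columns of $[y,\Omega], A[y,\Omega],\dots,A^{k-1}[y,\Omega]$ are linearly independent. $I$ is the $m\times m$ identity matrix and $\log$ of a symmetric positive definite matrix is the matrix logarithm. *)

theory Defs
  imports Complex_Main "Jordan_Normal_Form.VS_Connect"
begin

abbreviation vspan :: "nat \<Rightarrow> real vec set \<Rightarrow> real vec set" where
  "vspan m \<equiv> LinearCombinations.module.span class_ring (module_vec TYPE(real) m)"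

text \<open>Linear independence of a list as a family: a repeated vector makes it dependent.\<close>

definition lin_indpt_family :: "nat \<Rightarrow> real vec list \<Rightarrow> bool" where
  "lin_indpt_family m vs \<longleftrightarrow> set vs \<subseteq> carrier_vec m \<and> distinct vs \<and>
     \<not> LinearCombinations.module.lin_dep class_ring (module_vec TYPE(real) m) (set vs)"

definition krylov_cols :: "nat \<Rightarrow> real mat \<Rightarrow> real mat \<Rightarrow> real vec list" where
  "krylov_cols k A Z = concat (map (\<lambda>i. cols (A ^\<^sub>m i * Z)) [0..<k])"

definition krylov_space :: "nat \<Rightarrow> real mat \<Rightarrow> real mat \<Rightarrow> real vec set" where
  "krylov_space k A Z = vspan (dim_row Z) (set (krylov_cols k A Z))"

definition augment_col :: "real vec \<Rightarrow> real mat \<Rightarrow> real mat" where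
  "augment_col y Z = mat_of_cols (dim_vec y) (y # cols Z)"

text \<open>The number of columns of \<open>W\<close> is not prescribed; it is forced to be the dimension of \<open>S\<close>,
  since orthonormal columns are linearly independent.\<close>

definition orthonormal_basis_mat :: "nat \<Rightarrow> real mat \<Rightarrow> real vec set \<Rightarrow> bool" where
  "orthonormal_basis_mat m W S \<longleftrightarrow>
     W \<in> carrier_mat m (dim_col W) \<and>
     (\<forall>i<dim_col W. \<forall>j<dim_col W. col W i \<bullet> col W j = (if i = j then 1 else 0)) \<and>
     vspan m (set (cols W)) = S"

definition sym_psd_mat :: "nat \<Rightarrow> real mat \<Rightarrow> bool" where
  "sym_psd_mat m A \<longleftrightarrow> A \<in> carrier_mat m m \<and> transpose_mat A = A \<and>
     (\<forall>v \<in> carrier_vec m. 0 \<le> v \<bullet> (A *\<^sub>v v))"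

definition mat_trace :: "'a :: comm_monoid_add mat \<Rightarrow> 'a" where
  "mat_trace A = (\<Sum>i<dim_row A. A $$ (i,i))"

definition spectral_decomp :: "real mat \<Rightarrow> real mat \<Rightarrow> (nat \<Rightarrow> real) \<Rightarrow> bool" where
  "spectral_decomp B U d \<longleftrightarrow> (let n = dim_row B in
     B \<in> carrier_mat n n \<and> U \<in> carrier_mat n n \<and>
     transpose_mat U * U = 1\<^sub>m n \<and> U * transpose_mat U = 1\<^sub>m n \<and>
     B = U * mat_diag n d * transpose_mat U)"

text \<open>The matrix function \<open>f(B) = U f(D) U\<^sup>T\<close> of a symmetric matrix \<open>B = U D U\<^sup>T\<close>.
  By the spectral theorem such a decomposition exists for every symmetric \<open>B\<close>; the lemmas
  \<open>mat_fun_unique\<close> and \<open>mat_fun_eq\<close> show that the value does not depend on its choice.\<close>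

definition mat_fun :: "(real \<Rightarrow> real) \<Rightarrow> real mat \<Rightarrow> real mat" where
  "mat_fun f B = (THE X. \<exists>U d. spectral_decomp B U d \<and>
     X = U * mat_diag (dim_row B) (\<lambda>i. f (d i)) * transpose_mat U)"

definition mat_log :: "real mat \<Rightarrow> real mat" where
  "mat_log B = mat_fun ln B"

lemma mat_fun_unique:
  assumes U: "spectral_decomp B U d" and V: "spectral_decomp B V e"
  shows "U * mat_diag (dim_row B) (\<lambda>i. f (d i)) * transpose_mat U =
         V * mat_diag (dim_row B) (\<lambda>i. f (e i)) * transpose_mat V"
proof -
  define n where "n = dim_row B"
  let ?D = "\<lambda>g. mat_diag n g :: real mat"
  define C where "C = transpose_mat V * U"
  have u: "U \<in> carrier_mat n n" "transpose_mat U * U = 1\<^sub>m n" "U * transpose_mat U = 1\<^sub>m n"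
    and Bu: "B = U * ?D d * transpose_mat U"
    using U unfolding spectral_decomp_def n_def Let_def by auto
  have v: "V \<in> carrier_mat n n" "transpose_mat V * V = 1\<^sub>m n" "V * transpose_mat V = 1\<^sub>m n"
    and Bv: "B = V * ?D e * transpose_mat V"
    using V unfolding spectral_decomp_def n_def Let_def by auto
  have D: "?D g \<in> carrier_mat n n" for g by simp
  have ut: "transpose_mat U \<in> carrier_mat n n" and vt: "transpose_mat V \<in> carrier_mat n n"
    using u v by auto
  have C: "C \<in> carrier_mat n n" unfolding C_def using u vt by auto
  note as = assoc_mult_mat[of _ n n _ n _ n] mult_carrier_mat[of _ n n _ n]
    right_mult_one_mat[of _ n n]
  have l: "transpose_mat V * (U * ?D g * transpose_mat U) * U = C * ?D g" for g
    using u v ut vt D unfolding C_def by (simp add: as)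
  have r: "transpose_mat V * (V * ?D g * transpose_mat V) * U = ?D g * C" for g
  proof -
    have "transpose_mat V * (V * ?D g * transpose_mat V) * U
        = (transpose_mat V * V) * (?D g * C)"
      using u(1) v(1) ut vt D unfolding C_def by (simp add: as)
    also have "\<dots> = ?D g * C"
      using v(2) left_mult_one_mat[OF mult_carrier_mat[OF D C]] by simp
    finally show ?thesis .
  qed
  have eq: "C * ?D d = ?D e * C" using l[of d] r[of e] Bu Bv by simp
  have "C * ?D (\<lambda>i. f (d i)) = ?D (\<lambda>i. f (e i)) * C"
  proof (rule eq_matI)
    fix i j assume "i < dim_row (?D (\<lambda>i. f (e i)) * C)" "j < dim_col (?D (\<lambda>i. f (e i)) * C)"
    hence ij: "i < n" "j < n" using C by (auto simp: mat_diag_def)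
    have "(C * ?D d) $$ (i,j) = (?D e * C) $$ (i,j)" using eq by simp
    hence "C $$ (i,j) * d j = e i * C $$ (i,j)"
      using ij C by (simp add: mat_diag_mult_right[OF C] mat_diag_mult_left[OF C])
    hence "C $$ (i,j) = 0 \<or> d j = e i" by auto
    thus "(C * ?D (\<lambda>i. f (d i))) $$ (i,j) = (?D (\<lambda>i. f (e i)) * C) $$ (i,j)"
      using ij C by (auto simp: mat_diag_mult_right[OF C] mat_diag_mult_left[OF C])
  qed (use C in \<open>auto simp: mat_diag_def\<close>)
  hence *: "transpose_mat V * (U * ?D (\<lambda>i. f (d i)) * transpose_mat U) * U
      = transpose_mat V * (V * ?D (\<lambda>i. f (e i)) * transpose_mat V) * U"
    unfolding l r .
  have canc: "V * (transpose_mat V * X * U) * transpose_mat U = X"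
    if X: "X \<in> carrier_mat n n" for X
  proof -
    have "V * (transpose_mat V * X * U) * transpose_mat U
        = (V * transpose_mat V) * X * (U * transpose_mat U)"
      using u(1) v(1) ut vt X by (simp add: as)
    thus ?thesis using u v X by simp
  qed
  have "U * ?D (\<lambda>i. f (d i)) * transpose_mat U = V * ?D (\<lambda>i. f (e i)) * transpose_mat V"
    using arg_cong[OF *, of "\<lambda>X. V * X * transpose_mat U"] u(1) v(1) ut vt D
    by (subst (asm) canc, force, subst (asm) canc, force)
  thus ?thesis unfolding n_def .
qed

lemma mat_fun_eq:
  assumes "spectral_decomp B U d"
  shows "mat_fun f B = U * mat_diag (dim_row B) (\<lambda>i. f (d i)) * transpose_mat U"
  unfolding mat_fun_def
proof (rule the_equality)
  show "\<exists>V e. spectral_decomp B V e \<and>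
      U * mat_diag (dim_row B) (\<lambda>i. f (d i)) * transpose_mat U =
      V * mat_diag (dim_row B) (\<lambda>i. f (e i)) * transpose_mat V"
    using assms by blast
next
  fix X assume "\<exists>V e. spectral_decomp B V e \<and>
      X = V * mat_diag (dim_row B) (\<lambda>i. f (e i)) * transpose_mat V"
  thus "X = U * mat_diag (dim_row B) (\<lambda>i. f (d i)) * transpose_mat U"
    using mat_fun_unique[OF _ assms] by blast
qed

end

theory Submission
  imports Defs "Jordan_Normal_Form.Schur_Decomposition"
begin

text \<open>
  Put \<open>P = W W\<^sup>T\<close> and \<open>P' = W' W'\<^sup>T\<close>, the orthogonal projections onto the two Krylov spaces, so
  that \<open>W T W\<^sup>T = P A P\<close> and \<open>W' T' W'\<^sup>T = P' A P'\<close>. The first Krylov space is contained in the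
  second, hence \<open>P P' = P = P' P\<close> and \<open>P A P = P (P' A P') P\<close>. Both inequalities are therefore
  instances of one fact (\<open>trace_log_compression_le\<close>): replacing a positive semidefinite \<open>B\<close> by its
  compression \<open>P B P\<close> does not increase \<open>Tr (log (c I + B))\<close>. The first uses it for
  \<open>B = P' A P'\<close>, the second for \<open>B = A\<close> and the projection \<open>P'\<close>.

  The trace of the logarithm of a positive definite matrix is the logarithm of its determinant
  (\<open>mat_trace_mat_log\<close>), which turns that fact into an inequality between determinants
  (\<open>det_compression_le\<close>). The matrices \<open>P B P\<close> and \<open>B\<close> are in general not comparable in the Loewner
  order, so monotonicity of the determinant does not apply directly. Writing \<open>B = R R\<^sup>T\<close> and using
  \<open>det (c I + X Y) = det (c I + Y X)\<close> replaces \<open>P B P = (P R) (R\<^sup>T P)\<close> by \<open>R\<^sup>T P R\<close> and \<open>B\<close> by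
  \<open>R\<^sup>T R\<close>, and these are comparable, because \<open>P\<close> is below the identity.

  The matrix logarithm, the factorization of \<open>B\<close> and the monotonicity of the determinant all rest
  on the spectral theorem for real symmetric matrices (\<open>symmetric_mat_spectral_decomp\<close>).
\<close>

section \<open>The spectral theorem for real symmetric matrices\<close>

lemma symmetric_mat_scalar_prod:
  fixes A :: "real mat"
  assumes "A \<in> carrier_mat n n" "transpose_mat A = A" "v \<in> carrier_vec n" "w \<in> carrier_vec n"
  shows "v \<bullet> (A *\<^sub>v w) = w \<bullet> (A *\<^sub>v v)"
  using transpose_vec_mult_scalar[of A n n w v] assms
  by (metis comm_scalar_prod mult_mat_vec_carrier)

lemma real_scalar_prod_self_pos:
  fixes v :: "real vec"
  assumes "v \<in> carrier_vec n"
  shows "0 \<le> v \<bullet> v" "v \<noteq> 0\<^sub>v n \<Longrightarrow> 0 < v \<bullet> v"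
proof -
  show *: "0 \<le> v \<bullet> v"
    by (auto simp: scalar_prod_def intro: sum_nonneg)
  assume "v \<noteq> 0\<^sub>v n"
  then show "0 < v \<bullet> v"
    using conjugate_square_eq_0_vec[OF assms] * by simp
qed

text \<open>The fundamental theorem of algebra gives a complex eigenvector \<open>x + i y\<close>. Evaluating
  \<open>x \<bullet> A y = y \<bullet> A x\<close> with the real and imaginary parts of the eigenvalue equation shows that the
  imaginary part of the eigenvalue, times \<open>|x|\<^sup>2 + |y|\<^sup>2\<close>, is zero; then \<open>x\<close> and \<open>y\<close> themselves
  satisfy the eigenvalue equation, and one of them is nonzero.\<close>

lemma symmetric_mat_real_eigenvector:
  fixes A :: "real mat"
  assumes A: "A \<in> carrier_mat n n" and sym: "transpose_mat A = A" and n: "n \<noteq> 0"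
  obtains v e where "v \<in> carrier_vec n" "v \<noteq> 0\<^sub>v n" "A *\<^sub>v v = e \<cdot>\<^sub>v v"
proof -
  define C where "C = map_mat complex_of_real A"
  have C: "C \<in> carrier_mat n n" using A unfolding C_def by simp
  obtain zs where zs: "char_poly C = (\<Prod>z\<leftarrow>zs. [:- z, 1:])" "length zs = n"
    using char_poly_factorized[OF C] by blast
  obtain z zs' where "zs = z # zs'" using zs(2) n by (cases zs) auto
  then have "poly (char_poly C) z = 0" using zs(1) by simp
  then have "eigenvalue C z" using eigenvalue_root_char_poly[OF C] by simp
  then obtain w where w: "w \<in> carrier_vec n" "w \<noteq> 0\<^sub>v n" "C *\<^sub>v w = z \<cdot>\<^sub>v w"
    using C unfolding eigenvalue_def eigenvector_def by auto
  define x where "x = map_vec Re w"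
  define y where "y = map_vec Im w"
  have x: "x \<in> carrier_vec n" and y: "y \<in> carrier_vec n"
    using w(1) unfolding x_def y_def by auto
  have entry: "(\<Sum>j<n. complex_of_real (A $$ (i,j)) * w $ j) = z * w $ i" if "i < n" for i
  proof -
    have "(C *\<^sub>v w) $ i = (\<Sum>j<n. complex_of_real (A $$ (i,j)) * w $ j)"
      using that A w(1) by (auto simp: C_def scalar_prod_def lessThan_atLeast0)
    then show ?thesis using w that by auto
  qed
  have Ax: "A *\<^sub>v x = Re z \<cdot>\<^sub>v x - Im z \<cdot>\<^sub>v y"
  proof (rule eq_vecI)
    fix i assume "i < dim_vec (Re z \<cdot>\<^sub>v x - Im z \<cdot>\<^sub>v y)"
    then have i: "i < n" using x y by auto
    have "(A *\<^sub>v x) $ i = (\<Sum>j<n. A $$ (i,j) * Re (w $ j))"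
      using i A w(1) by (auto simp: x_def scalar_prod_def lessThan_atLeast0)
    also have "\<dots> = (Re z \<cdot>\<^sub>v x - Im z \<cdot>\<^sub>v y) $ i"
      using arg_cong[OF entry[OF i], of Re] i w(1) by (auto simp: x_def y_def)
    finally show "(A *\<^sub>v x) $ i = (Re z \<cdot>\<^sub>v x - Im z \<cdot>\<^sub>v y) $ i" .
  qed (use A x y in auto)
  have Ay: "A *\<^sub>v y = Im z \<cdot>\<^sub>v x + Re z \<cdot>\<^sub>v y"
  proof (rule eq_vecI)
    fix i assume "i < dim_vec (Im z \<cdot>\<^sub>v x + Re z \<cdot>\<^sub>v y)"
    then have i: "i < n" using x y by auto
    have "(A *\<^sub>v y) $ i = (\<Sum>j<n. A $$ (i,j) * Im (w $ j))"
      using i A w(1) by (auto simp: y_def scalar_prod_def lessThan_atLeast0)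
    also have "\<dots> = (Im z \<cdot>\<^sub>v x + Re z \<cdot>\<^sub>v y) $ i"
      using arg_cong[OF entry[OF i], of Im] i w(1) by (auto simp: x_def y_def)
    finally show "(A *\<^sub>v y) $ i = (Im z \<cdot>\<^sub>v x + Re z \<cdot>\<^sub>v y) $ i" .
  qed (use A x y in auto)
  have xy: "x \<noteq> 0\<^sub>v n \<or> y \<noteq> 0\<^sub>v n"
  proof (rule ccontr)
    assume "\<not> ?thesis"
    then have "Re (w $ i) = 0" "Im (w $ i) = 0" if "i < n" for i
      using w(1) that unfolding x_def y_def by (metis carrier_vecD index_map_vec(1) index_zero_vec(1))+
    then have "w = 0\<^sub>v n" using w(1) by (intro eq_vecI) (auto simp: complex_eq_iff)
    with w(2) show False by simp
  qed
  have "Im z * (x \<bullet> x) + Re z * (x \<bullet> y) = x \<bullet> (A *\<^sub>v y)"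
    unfolding Ay using x y by (simp add: scalar_prod_add_distrib[of _ n])
  also have "\<dots> = y \<bullet> (A *\<^sub>v x)" using symmetric_mat_scalar_prod[OF A sym x y] .
  also have "\<dots> = Re z * (x \<bullet> y) - Im z * (y \<bullet> y)"
    unfolding Ax using x y by (simp add: scalar_prod_minus_distrib[of _ n] comm_scalar_prod[of y n x])
  finally have "Im z * (x \<bullet> x + y \<bullet> y) = 0" by (simp add: algebra_simps)
  moreover have "x \<bullet> x + y \<bullet> y > 0"
    using xy real_scalar_prod_self_pos[OF x] real_scalar_prod_self_pos[OF y] by fastforce
  ultimately have Im: "Im z = 0" by simp
  have "A *\<^sub>v x = Re z \<cdot>\<^sub>v x" "A *\<^sub>v y = Re z \<cdot>\<^sub>v y"
    unfolding Ax Ay Im using x y by (intro eq_vecI; auto)+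
  with xy x y that show ?thesis by blast
qed

text \<open>Gram-Schmidt applied to a basis that starts with \<open>v\<close> keeps \<open>v\<close> as the first vector; the final
  normalization then rescales it, whence the factor \<open>a\<close>.\<close>

lemma orthogonal_mat_with_first_col:
  fixes v :: "real vec"
  assumes v: "v \<in> carrier_vec n" and v0: "v \<noteq> 0\<^sub>v n" and n: "n \<noteq> 0"
  obtains Q a where "Q \<in> carrier_mat n n" "transpose_mat Q * Q = 1\<^sub>m n" "col Q 0 = a \<cdot>\<^sub>v v"
proof -
  interpret cof_vec_space n "TYPE(real)" .
  define ws where "ws = gram_schmidt n (basis_completion v)"
  note b = basis_completion[OF v v0]
  obtain bs where bs: "basis_completion v = v # bs"
    using b(6,7) n by (cases "basis_completion v") auto
  have ws: "corthogonal ws" "set ws \<subseteq> carrier_vec n" "length ws = n"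
    using gram_schmidt_result[OF b(2,4,5) refl, folded ws_def] b(6) by auto
  have hd: "ws ! 0 = v"
    using gram_schmidt_hd[OF v, of bs] ws(3) n unfolding ws_def bs
    by (metis hd_conv_nth length_0_conv)
  have wsc: "ws ! i \<in> carrier_vec n" if "i < n" for i using ws that by auto
  define f where "f u = (1 / sqrt (u \<bullet> u)) \<cdot>\<^sub>v u" for u :: "real vec"
  define Q where "Q = mat_of_cols n (map f ws)"
  have Q: "Q \<in> carrier_mat n n" unfolding Q_def using ws(3) mat_of_cols_carrier(1)[of n "map f ws"] by simp
  have col: "col Q i = f (ws ! i)" if "i < n" for i
    unfolding Q_def using that ws(3) wsc[OF that]
    by (subst col_mat_of_cols) (auto simp: f_def)
  have "transpose_mat Q * Q = 1\<^sub>m n"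
  proof (rule eq_matI)
    fix i j assume "i < dim_row (1\<^sub>m n :: real mat)" "j < dim_col (1\<^sub>m n :: real mat)"
    then have ij: "i < n" "j < n" by auto
    have "(transpose_mat Q * Q) $$ (i,j) = f (ws ! i) \<bullet> f (ws ! j)"
      using ij Q col by auto
    also have "\<dots> = (ws ! i \<bullet> ws ! j) / (sqrt (ws ! i \<bullet> ws ! i) * sqrt (ws ! j \<bullet> ws ! j))"
      unfolding f_def using wsc[OF ij(1)] wsc[OF ij(2)] by simp
    also have "\<dots> = (if i = j then 1 else 0)"
    proof -
      have "(ws ! i \<bullet> ws ! j = 0) = (i \<noteq> j)"
        using corthogonalD[OF ws(1), of i j] ij ws(3) by simp
      moreover have "0 \<le> ws ! i \<bullet> ws ! i"
        using real_scalar_prod_self_pos(1)[OF wsc[OF ij(1)]] .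
      ultimately show ?thesis by auto
    qed
    finally show "(transpose_mat Q * Q) $$ (i,j) = (1\<^sub>m n :: real mat) $$ (i,j)"
      using ij by simp
  qed (use Q in auto)
  moreover have "col Q 0 = (1 / sqrt (v \<bullet> v)) \<cdot>\<^sub>v v"
    using col[of 0] n hd by (simp add: f_def)
  ultimately show ?thesis using that Q by blast
qed

text \<open>Deflation: in an orthonormal basis that starts with an eigenvector, the first column of the matrix
  vanishes below the diagonal, by symmetry so does the first row to its right, and the remaining
  block is again symmetric.\<close>

lemma symmetric_mat_orthogonally_diagonalizable:
  fixes A :: "real mat"
  assumes "A \<in> carrier_mat n n" "transpose_mat A = A"
  shows "\<exists>U d. U \<in> carrier_mat n n \<and> transpose_mat U * U = 1\<^sub>m n \<and>
    transpose_mat U * A * U = mat_diag n d"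
  using assms
proof (induction n arbitrary: A)
  case 0
  then show ?case
    by (intro exI[of _ "1\<^sub>m 0"] exI[of _ "\<lambda>_. 0"]) (auto simp: mat_diag_def intro!: eq_matI)
next
  case (Suc n)
  note A = Suc.prems(1) and sym = Suc.prems(2)
  obtain v e where v: "v \<in> carrier_vec (Suc n)" "v \<noteq> 0\<^sub>v (Suc n)" "A *\<^sub>v v = e \<cdot>\<^sub>v v"
    using symmetric_mat_real_eigenvector[OF A sym] by auto
  obtain Q a where Q: "Q \<in> carrier_mat (Suc n) (Suc n)"
    and QQ: "transpose_mat Q * Q = 1\<^sub>m (Suc n)" and col0: "col Q 0 = a \<cdot>\<^sub>v v"
    using orthogonal_mat_with_first_col[OF v(1,2)] by auto
  let ?B = "transpose_mat Q * A * Q"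
  have B: "?B \<in> carrier_mat (Suc n) (Suc n)" using Q A by auto
  have Bsym: "transpose_mat ?B = ?B"
    using Q A sym by (simp add: transpose_mult[of _ "Suc n" "Suc n" _ "Suc n"])
  have Aq: "A *\<^sub>v col Q 0 = e \<cdot>\<^sub>v col Q 0"
    unfolding col0 using mult_mat_vec[OF A v(1)] v by (simp add: smult_smult_assoc mult.commute)
  have B0: "?B $$ (i,0) = (if i = 0 then e else 0)" if i: "i < Suc n" for i
  proof -
    have "?B $$ (i,0) = (transpose_mat Q * (A * Q)) $$ (i,0)"
      using Q A by simp
    also have "\<dots> = col Q i \<bullet> (A *\<^sub>v col Q 0)"
      using i Q A by (subst index_mult_mat) (auto simp: mult_mat_vec_def)
    also have "\<dots> = e * (transpose_mat Q * Q) $$ (i,0)"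
      unfolding Aq using i Q by auto
    finally show ?thesis unfolding QQ using i by auto
  qed
  have B0': "?B $$ (0,i) = (if i = 0 then e else 0)" if i: "i < Suc n" for i
    using B0[OF i] Bsym B i by (metis carrier_matD index_transpose_mat(1) zero_less_Suc)
  define A3 where "A3 = mat n n (\<lambda>(i,j). ?B $$ (Suc i, Suc j))"
  have A3: "A3 \<in> carrier_mat n n" unfolding A3_def by simp
  have A3sym: "transpose_mat A3 = A3"
  proof (rule eq_matI)
    fix i j assume "i < dim_row A3" "j < dim_col A3"
    then have ij: "i < n" "j < n" using A3 by auto
    then have "?B $$ (Suc j, Suc i) = ?B $$ (Suc i, Suc j)"
      using Bsym B by (metis Suc_mono carrier_matD index_transpose_mat(1))
    then show "transpose_mat A3 $$ (i,j) = A3 $$ (i,j)" using ij by (simp add: A3_def)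
  qed (use A3 in auto)
  obtain U d where U: "U \<in> carrier_mat n n" and UU: "transpose_mat U * U = 1\<^sub>m n"
    and UAU: "transpose_mat U * A3 * U = mat_diag n d"
    using Suc.IH[OF A3 A3sym] by blast
  let ?E = "e \<cdot>\<^sub>m 1\<^sub>m 1 :: real mat"
  let ?F = "four_block_mat (1\<^sub>m 1) (0\<^sub>m 1 n) (0\<^sub>m n 1) U"
  let ?Ft = "four_block_mat (1\<^sub>m 1) (0\<^sub>m 1 n) (0\<^sub>m n 1) (transpose_mat U)"
  have Bblk: "?B = four_block_mat ?E (0\<^sub>m 1 n) (0\<^sub>m n 1) A3"
  proof (rule eq_matI)
    fix i j assume "i < dim_row (four_block_mat ?E (0\<^sub>m 1 n) (0\<^sub>m n 1) A3)"
      "j < dim_col (four_block_mat ?E (0\<^sub>m 1 n) (0\<^sub>m n 1) A3)"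
    then have ij: "i < Suc n" "j < Suc n" using A3 by auto
    show "?B $$ (i,j) = four_block_mat ?E (0\<^sub>m 1 n) (0\<^sub>m n 1) A3 $$ (i,j)"
    proof (cases "i = 0 \<or> j = 0")
      case True
      then show ?thesis using B0[OF ij(1)] B0'[OF ij(2)] ij A3 by auto
    next
      case False
      then obtain i' j' where "i = Suc i'" "j = Suc j'" by (metis not0_implies_Suc)
      then show ?thesis using ij by (simp add: A3_def)
    qed
  qed (use B A3 in auto)
  have Ft: "transpose_mat ?F = ?Ft"
    using U by (subst transpose_four_block_mat[of _ 1 1 _ n _ n]) auto
  have F: "?F \<in> carrier_mat (Suc n) (Suc n)" "?Ft \<in> carrier_mat (Suc n) (Suc n)"
    using U four_block_carrier_mat[of "1\<^sub>m 1" 1 1 U n n]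
      four_block_carrier_mat[of "1\<^sub>m 1" 1 1 "transpose_mat U" n n] by auto
  have FF: "?Ft * ?F = 1\<^sub>m (Suc n)"
    using U UU by (subst mult_four_block_mat[of _ 1 1 _ n _ n]) auto
  have FBF: "?Ft * ?B * ?F = mat_diag (Suc n) (case_nat e d)"
  proof -
    have "?Ft * ?B * ?F = four_block_mat ?E (0\<^sub>m 1 n) (0\<^sub>m n 1) (mat_diag n d)"
      unfolding Bblk using U A3 UAU
      by (subst mult_four_block_mat[of _ 1 1 _ n _ n], auto, subst mult_four_block_mat[of _ 1 1 _ n _ n], auto)
    also have "\<dots> = mat_diag (Suc n) (case_nat e d)"
      by (rule eq_matI) (auto simp: mat_diag_def split: nat.splits)
    finally show ?thesis .
  qed
  have QF: "transpose_mat (Q * ?F) = ?Ft * transpose_mat Q"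
    using transpose_mult[OF Q F(1)] Ft by simp
  have "transpose_mat (Q * ?F) * (Q * ?F) = ?Ft * (transpose_mat Q * Q) * ?F"
    unfolding QF using Q F by (simp add: assoc_mult_mat[of _ "Suc n" "Suc n" _ "Suc n" _ "Suc n"])
  then have 1: "transpose_mat (Q * ?F) * (Q * ?F) = 1\<^sub>m (Suc n)"
    unfolding QQ right_mult_one_mat[OF F(2)] FF .
  have "transpose_mat (Q * ?F) * A * (Q * ?F) = ?Ft * ?B * ?F"
    unfolding QF using Q F A by (simp add: assoc_mult_mat[of _ "Suc n" "Suc n" _ "Suc n" _ "Suc n"])
  then show ?case using 1 FBF Q F by (intro exI[of _ "Q * ?F"] exI[of _ "case_nat e d"]) auto
qed

theorem symmetric_mat_spectral_decomp:
  fixes A :: "real mat"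
  assumes A: "A \<in> carrier_mat n n" and sym: "transpose_mat A = A"
  obtains U d where "spectral_decomp A U d"
proof -
  obtain U d where U: "U \<in> carrier_mat n n" "transpose_mat U * U = 1\<^sub>m n"
    and D: "transpose_mat U * A * U = mat_diag n d"
    using symmetric_mat_orthogonally_diagonalizable[OF A sym] by blast
  have Ut: "transpose_mat U \<in> carrier_mat n n" using U by simp
  have UU: "U * transpose_mat U = 1\<^sub>m n"
    using mat_mult_left_right_inverse[OF Ut U(1) U(2)] .
  have "U * mat_diag n d * transpose_mat U = (U * transpose_mat U) * A * (U * transpose_mat U)"
    unfolding D[symmetric] using U(1) Ut A by (simp add: assoc_mult_mat[of _ n n _ n _ n])
  also have "\<dots> = A" unfolding UU using A by simp
  finally show ?thesis using that[of U d] U UU A unfolding spectral_decomp_def by auto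
qed

section \<open>Determinants of symmetric matrices\<close>

lemma spectral_decompD:
  assumes "spectral_decomp B U d" "B \<in> carrier_mat n n"
  shows "U \<in> carrier_mat n n" "transpose_mat U * U = 1\<^sub>m n" "U * transpose_mat U = 1\<^sub>m n"
    "B = U * mat_diag n d * transpose_mat U"
  using assms unfolding spectral_decomp_def Let_def by auto

lemma det_spectral_decomp:
  assumes "spectral_decomp B U d" and "B \<in> carrier_mat n n"
  shows "det B = (\<Prod>i<n. d i)"
proof -
  note U = spectral_decompD[OF assms]
  have D: "det (mat_diag n d) = (\<Prod>i<n. d i)"
  proof -
    have "det (mat_diag n d) = prod_list (diag_mat (mat_diag n d))"
      by (rule det_upper_triangular[of _ n]) (auto simp: mat_diag_def)
    also have "\<dots> = prod_list (map d [0..<n])"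
      unfolding diag_mat_def by (intro arg_cong[of _ _ prod_list]) (auto simp: mat_diag_def)
    finally show ?thesis by (simp add: prod.list_conv_set_nth lessThan_atLeast0)
  qed
  have "det U * det (transpose_mat U) = 1"
    using det_mult[OF U(1), of "transpose_mat U"] U(1,3) by simp
  moreover have "det B = det U * det (mat_diag n d) * det (transpose_mat U)"
    unfolding U(4) using U(1) by (simp add: det_mult[of _ n])
  ultimately show ?thesis using D by (simp add: algebra_simps)
qed

text \<open>The number \<open>d i\<close> is the value of the quadratic form of \<open>B\<close> at the unit vector \<open>col U i\<close>.\<close>

lemma spectral_decomp_eigenvalue_ge:
  assumes dec: "spectral_decomp B U d" and B: "B \<in> carrier_mat n n"
    and ge: "\<And>v. v \<in> carrier_vec n \<Longrightarrow> c * (v \<bullet> v) \<le> v \<bullet> (B *\<^sub>v v)"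
    and i: "i < n"
  shows "c \<le> d i"
proof -
  note U = spectral_decompD[OF dec B]
  have Ut: "transpose_mat U \<in> carrier_mat n n" using U(1) by simp
  have D: "mat_diag n d \<in> carrier_mat n n" by simp
  have "transpose_mat U * (B * U) = (transpose_mat U * U) * mat_diag n d * (transpose_mat U * U)"
    unfolding U(4) using U(1) Ut D
    by (simp add: assoc_mult_mat[of _ n n _ n _ n] mult_carrier_mat[of _ n n _ n])
  then have "transpose_mat U * (B * U) = mat_diag n d"
    unfolding U(2) using left_mult_one_mat[OF D] right_mult_one_mat[OF D] by simp
  then have "d i = (transpose_mat U * (B * U)) $$ (i,i)" using i by (simp add: mat_diag_def)
  also have "\<dots> = col U i \<bullet> (B *\<^sub>v col U i)"
    using i U(1) B by (subst index_mult_mat) (auto simp: mult_mat_vec_def)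
  also have "\<dots> \<ge> c * (col U i \<bullet> col U i)"
    using i U(1) by (intro ge) auto
  also have "col U i \<bullet> col U i = (transpose_mat U * U) $$ (i,i)"
    using i U(1) by auto
  finally show ?thesis using i unfolding U(2) by simp
qed

text \<open>Positive definiteness enters as a uniform lower bound \<open>c\<close> on the quadratic form, the shape in which
  \<open>c I + B\<close> supplies it. Both sides of the equation are
  the sum of the logarithms of the eigenvalues.\<close>

lemma mat_trace_mat_log:
  fixes B :: "real mat"
  assumes B: "B \<in> carrier_mat n n" and sym: "transpose_mat B = B" and c: "0 < c"
    and ge: "\<And>v. v \<in> carrier_vec n \<Longrightarrow> c * (v \<bullet> v) \<le> v \<bullet> (B *\<^sub>v v)"
  shows "mat_trace (mat_log B) = ln (det B)" and "0 < det B"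
proof -
  obtain U d where dec: "spectral_decomp B U d"
    using symmetric_mat_spectral_decomp[OF B sym] .
  note U = spectral_decompD[OF dec B]
  have d: "0 < d i" if "i < n" for i
    using spectral_decomp_eigenvalue_ge[OF dec B ge that] c by simp
  show "0 < det B"
    unfolding det_spectral_decomp[OF dec B] using d by (intro prod_pos) auto
  have col: "(\<Sum>i<n. U $$ (i,j) * U $$ (i,j)) = 1" if "j < n" for j
  proof -
    have "(transpose_mat U * U) $$ (j,j) = (\<Sum>i<n. U $$ (i,j) * U $$ (i,j))"
      using that U(1) by (auto simp: scalar_prod_def lessThan_atLeast0)
    then show ?thesis using that unfolding U(2) by simp
  qed
  have L: "mat_log B = U * mat_diag n (\<lambda>i. ln (d i)) * transpose_mat U"
    unfolding mat_log_def using mat_fun_eq[OF dec] B by simp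
  have "mat_trace (mat_log B) = (\<Sum>i<n. \<Sum>j<n. U $$ (i,j) * ln (d j) * U $$ (i,j))"
    unfolding L mat_trace_def mat_diag_mult_right[OF U(1)]
    using U(1) by (auto simp: scalar_prod_def lessThan_atLeast0 intro!: sum.cong)
  also have "\<dots> = (\<Sum>j<n. ln (d j) * (\<Sum>i<n. U $$ (i,j) * U $$ (i,j)))"
    by (subst sum.swap) (simp add: sum_distrib_left algebra_simps)
  also have "\<dots> = (\<Sum>j<n. ln (d j))" using col by simp
  also have "\<dots> = ln (\<Prod>j<n. d j)" using d[THEN less_imp_neq] d by (subst ln_prod) auto
  finally show "mat_trace (mat_log B) = ln (det B)"
    unfolding det_spectral_decomp[OF dec B] .
qed

lemma scalar_prod_congruence:
  fixes S G :: "real mat"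
  assumes "S \<in> carrier_mat n n" "G \<in> carrier_mat n m" "v \<in> carrier_vec m"
  shows "v \<bullet> ((transpose_mat G * S * G) *\<^sub>v v) = (G *\<^sub>v v) \<bullet> (S *\<^sub>v (G *\<^sub>v v))"
proof -
  have "(transpose_mat G * S * G) *\<^sub>v v = transpose_mat G *\<^sub>v (S *\<^sub>v (G *\<^sub>v v))"
    using assms by (simp add: assoc_mult_mat_vec[of _ m n _ m] assoc_mult_mat_vec[of _ m n _ n])
  then show ?thesis
    using assms transpose_vec_mult_scalar[of G n m v "S *\<^sub>v (G *\<^sub>v v)"]
    by (metis comm_scalar_prod mult_mat_vec_carrier transpose_carrier_mat)
qed

text \<open>A congruence reduces the claim to \<open>S = I\<close>: if \<open>S = U diag(d) U\<^sup>T\<close>, scaling column \<open>i\<close> of \<open>U\<close> by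
  \<open>1 / sqrt (d i)\<close> gives a matrix \<open>G\<close> with \<open>G\<^sup>T S G = I\<close>. Then every eigenvalue of \<open>G\<^sup>T M G\<close> is at least one, and the factor \<open>(det G)\<^sup>2\<close> cancels.\<close>

lemma det_mono_positive_definite:
  fixes S M :: "real mat"
  assumes S: "S \<in> carrier_mat n n" "transpose_mat S = S"
    and M: "M \<in> carrier_mat n n" "transpose_mat M = M"
    and c: "0 < c" and pos: "\<And>v. v \<in> carrier_vec n \<Longrightarrow> c * (v \<bullet> v) \<le> v \<bullet> (S *\<^sub>v v)"
    and le: "\<And>v. v \<in> carrier_vec n \<Longrightarrow> v \<bullet> (S *\<^sub>v v) \<le> v \<bullet> (M *\<^sub>v v)"
  shows "det S \<le> det M"
proof -
  obtain U d where dec: "spectral_decomp S U d"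
    using symmetric_mat_spectral_decomp[OF S] .
  note U = spectral_decompD[OF dec S(1)]
  have d: "0 < d i" if "i < n" for i
    using spectral_decomp_eigenvalue_ge[OF dec S(1) pos that] c by simp
  define D where "D = mat_diag n (\<lambda>i. 1 / sqrt (d i))"
  have D: "D \<in> carrier_mat n n" "transpose_mat D = D"
    unfolding D_def by (auto simp: mat_diag_def)
  have E: "mat_diag n d \<in> carrier_mat n n" by simp
  have DED: "D * mat_diag n d * D = 1\<^sub>m n"
  proof -
    have "D * mat_diag n d * D = mat_diag n (\<lambda>i. 1 / sqrt (d i) * d i * (1 / sqrt (d i)))"
      unfolding D_def by simp
    also have "\<dots> = 1\<^sub>m n"
      using d[THEN less_imp_neq] d[THEN less_imp_le] by (intro eq_matI) (auto simp: mat_diag_def)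
    finally show ?thesis .
  qed
  define G where "G = U * D"
  have G: "G \<in> carrier_mat n n" and Gt: "transpose_mat G = D * transpose_mat U"
    unfolding G_def using U(1) D transpose_mult[OF U(1) D(1)] by auto
  have "transpose_mat G * S * G = D * (transpose_mat U * U) * mat_diag n d * (transpose_mat U * U) * D"
    unfolding Gt unfolding G_def U(4) using U(1) D(1) E
    by (simp add: assoc_mult_mat[of _ n n _ n _ n] mult_carrier_mat[of _ n n _ n])
  then have GSG: "transpose_mat G * S * G = 1\<^sub>m n"
    unfolding U(2) using D(1) E DED by simp
  have det_congr: "det (transpose_mat G * X * G) = (det G)\<^sup>2 * det X" if "X \<in> carrier_mat n n" for X
    using that G by (simp add: det_mult[of _ n] det_transpose power2_eq_square)
  have one: "(det G)\<^sup>2 * det S = 1" using det_congr[OF S(1)] GSG by simp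
  let ?K = "transpose_mat G * M * G"
  have K: "?K \<in> carrier_mat n n" using G M by simp
  have Ksym: "transpose_mat ?K = ?K"
    using G M by (simp add: transpose_mult[of _ n n _ n])
  have Kge: "1 * (v \<bullet> v) \<le> v \<bullet> (?K *\<^sub>v v)" if v: "v \<in> carrier_vec n" for v
  proof -
    have "v \<bullet> v = v \<bullet> ((transpose_mat G * S * G) *\<^sub>v v)" unfolding GSG using v by simp
    also have "\<dots> = (G *\<^sub>v v) \<bullet> (S *\<^sub>v (G *\<^sub>v v))"
      using scalar_prod_congruence[OF S(1) G v] .
    also have "\<dots> \<le> (G *\<^sub>v v) \<bullet> (M *\<^sub>v (G *\<^sub>v v))" using G v by (intro le) auto
    also have "\<dots> = v \<bullet> (?K *\<^sub>v v)" using scalar_prod_congruence[OF M(1) G v] by simp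
    finally show ?thesis by simp
  qed
  obtain V e where dec': "spectral_decomp ?K V e"
    using symmetric_mat_spectral_decomp[OF K Ksym] .
  have "1 \<le> det ?K"
    unfolding det_spectral_decomp[OF dec' K]
    using spectral_decomp_eigenvalue_ge[OF dec' K Kge] by (intro prod_ge_1) auto
  then have "(det G)\<^sup>2 * det S \<le> (det G)\<^sup>2 * det M" using one det_congr[OF M(1)] by simp
  moreover have "0 < (det G)\<^sup>2" using one by (metis mult_zero_left zero_less_power2 zero_neq_one power_zero_numeral)
  ultimately show ?thesis by simp
qed

text \<open>The Weinstein--Aronszajn identity: both sides are the determinant of the block matrix with rows
  \<open>(c I, - X)\<close> and \<open>(Y, I)\<close>, computed directly on the left, and after clearing the upper right
  block on the right.\<close>

lemma det_smult_one_add_mult_commute: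
  fixes X Y :: "'a :: field mat"
  assumes X: "X \<in> carrier_mat n n" and Y: "Y \<in> carrier_mat n n" and c: "c \<noteq> 0"
  shows "det (c \<cdot>\<^sub>m 1\<^sub>m n + X * Y) = det (c \<cdot>\<^sub>m 1\<^sub>m n + Y * X)"
proof -
  let ?M = "four_block_mat (c \<cdot>\<^sub>m 1\<^sub>m n) (- X) Y (1\<^sub>m n)"
  let ?Z = "inverse c \<cdot>\<^sub>m X"
  let ?N = "four_block_mat (1\<^sub>m n) ?Z (0\<^sub>m n n) (1\<^sub>m n)"
  have M: "?M \<in> carrier_mat (n + n) (n + n)" and N: "?N \<in> carrier_mat (n + n) (n + n)"
    by auto
  have "det ?M = det (c \<cdot>\<^sub>m 1\<^sub>m n * 1\<^sub>m n - (- X) * Y)"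
    using X Y by (intro det_four_block_mat) auto
  also have "c \<cdot>\<^sub>m 1\<^sub>m n * 1\<^sub>m n - (- X) * Y = c \<cdot>\<^sub>m 1\<^sub>m n + X * Y"
    using X Y by (intro eq_matI) auto
  finally have 1: "det ?M = det (c \<cdot>\<^sub>m 1\<^sub>m n + X * Y)" .
  have "?M * ?N = four_block_mat (c \<cdot>\<^sub>m 1\<^sub>m n * 1\<^sub>m n + - X * 0\<^sub>m n n)
      (c \<cdot>\<^sub>m 1\<^sub>m n * ?Z + - X * 1\<^sub>m n) (Y * 1\<^sub>m n + 1\<^sub>m n * 0\<^sub>m n n) (Y * ?Z + 1\<^sub>m n * 1\<^sub>m n)"
    using X Y by (intro mult_four_block_mat) auto
  also have "c \<cdot>\<^sub>m 1\<^sub>m n * 1\<^sub>m n + - X * 0\<^sub>m n n = c \<cdot>\<^sub>m 1\<^sub>m n"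
    using X by (intro eq_matI) auto
  also have "c \<cdot>\<^sub>m 1\<^sub>m n * ?Z + - X * 1\<^sub>m n = 0\<^sub>m n n"
    using X c by (intro eq_matI) auto
  also have "Y * ?Z + 1\<^sub>m n * 1\<^sub>m n = 1\<^sub>m n + inverse c \<cdot>\<^sub>m (Y * X)"
    using X Y by (intro eq_matI) auto
  also have "Y * 1\<^sub>m n + 1\<^sub>m n * 0\<^sub>m n n = Y"
    using Y by auto
  finally have "det (?M * ?N) = det (four_block_mat (c \<cdot>\<^sub>m 1\<^sub>m n) (0\<^sub>m n n) Y (1\<^sub>m n + inverse c \<cdot>\<^sub>m (Y * X)))"
    by simp
  also have "\<dots> = det (c \<cdot>\<^sub>m 1\<^sub>m n :: 'a mat) * det (1\<^sub>m n + inverse c \<cdot>\<^sub>m (Y * X))"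
    using X Y by (intro det_four_block_mat_upper_right_zero) auto
  also have "\<dots> = det (c \<cdot>\<^sub>m (1\<^sub>m n + inverse c \<cdot>\<^sub>m (Y * X)))"
    using X by simp
  also have "c \<cdot>\<^sub>m (1\<^sub>m n + inverse c \<cdot>\<^sub>m (Y * X)) = c \<cdot>\<^sub>m 1\<^sub>m n + Y * X"
    using X Y c by (intro eq_matI) (auto simp: field_simps)
  finally have "det (?M * ?N) = det (c \<cdot>\<^sub>m 1\<^sub>m n + Y * X)" .
  moreover have "det ?N = 1"
    using X by (subst det_four_block_mat_lower_left_zero[of _ n _ n]) auto
  ultimately show ?thesis using 1 det_mult[OF M N] by simp
qed

lemma psd_mat_factorization:
  assumes "sym_psd_mat n B"
  obtains R where "R \<in> carrier_mat n n" "B = R * transpose_mat R"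
proof -
  have B: "B \<in> carrier_mat n n" "transpose_mat B = B"
    and pos: "\<And>v. v \<in> carrier_vec n \<Longrightarrow> 0 * (v \<bullet> v) \<le> v \<bullet> (B *\<^sub>v v)"
    using assms unfolding sym_psd_mat_def by auto
  obtain U d where dec: "spectral_decomp B U d"
    using symmetric_mat_spectral_decomp[OF B] .
  note U = spectral_decompD[OF dec B(1)]
  have d: "0 \<le> d i" if "i < n" for i
    using spectral_decomp_eigenvalue_ge[OF dec B(1) pos that] .
  define D where "D = mat_diag n (\<lambda>i. sqrt (d i))"
  have D: "D \<in> carrier_mat n n" "transpose_mat D = D"
    unfolding D_def by (auto simp: mat_diag_def)
  have DD: "D * D = mat_diag n d"
    unfolding D_def using d by (simp, intro eq_matI) (auto simp: mat_diag_def)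
  have "(U * D) * transpose_mat (U * D) = U * (D * D) * transpose_mat U"
    using U(1) D by (simp add: transpose_mult[of _ n n _ n] assoc_mult_mat[of _ n n _ n _ n])
  then show ?thesis using that[of "U * D"] U(1,4) D DD by simp
qed

section \<open>Compression by an orthogonal projection\<close>

definition orth_proj_mat :: "nat \<Rightarrow> real mat \<Rightarrow> bool" where
  "orth_proj_mat n P \<longleftrightarrow> P \<in> carrier_mat n n \<and> transpose_mat P = P \<and> P * P = P"

text \<open>For an orthogonal projection, \<open>v \<bullet> P v = |P v|\<^sup>2\<close> and \<open>v \<bullet> v - v \<bullet> P v = |v - P v|\<^sup>2\<close>.\<close>

lemma orth_proj_mat_scalar_prod:
  assumes P: "orth_proj_mat n P" and v: "v \<in> carrier_vec n"
  shows "0 \<le> v \<bullet> (P *\<^sub>v v)" and "v \<bullet> (P *\<^sub>v v) \<le> v \<bullet> v"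
proof -
  have c: "P \<in> carrier_mat n n" "transpose_mat P = P" "P * P = P"
    using P unfolding orth_proj_mat_def by auto
  let ?w = "P *\<^sub>v v"
  have w: "?w \<in> carrier_vec n" using c v by simp
  have ww: "?w \<bullet> ?w = v \<bullet> ?w"
    using transpose_vec_mult_scalar[OF c(1) w v] c v
    by (metis assoc_mult_mat_vec)
  show "0 \<le> v \<bullet> ?w" using real_scalar_prod_self_pos(1)[OF w] ww by simp
  have "0 \<le> (v - ?w) \<bullet> (v - ?w)"
    using real_scalar_prod_self_pos(1)[of "v - ?w" n] v w by simp
  also have "\<dots> = v \<bullet> v - v \<bullet> ?w"
    using v w ww comm_scalar_prod[OF w v]
    by (simp add: scalar_prod_minus_distrib[of _ n] minus_scalar_prod_distrib[of _ n])
  finally show "v \<bullet> ?w \<le> v \<bullet> v" by simp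
qed

lemma shifted_psd_mat:
  assumes "sym_psd_mat n B"
  shows "c \<cdot>\<^sub>m 1\<^sub>m n + B \<in> carrier_mat n n"
    and "transpose_mat (c \<cdot>\<^sub>m 1\<^sub>m n + B) = c \<cdot>\<^sub>m 1\<^sub>m n + B"
    and "v \<in> carrier_vec n \<Longrightarrow> v \<bullet> ((c \<cdot>\<^sub>m 1\<^sub>m n + B) *\<^sub>v v) = c * (v \<bullet> v) + v \<bullet> (B *\<^sub>v v)"
    and "v \<in> carrier_vec n \<Longrightarrow> c * (v \<bullet> v) \<le> v \<bullet> ((c \<cdot>\<^sub>m 1\<^sub>m n + B) *\<^sub>v v)"
proof -
  have B: "B \<in> carrier_mat n n" "transpose_mat B = B"
    using assms unfolding sym_psd_mat_def by auto
  show "c \<cdot>\<^sub>m 1\<^sub>m n + B \<in> carrier_mat n n" using B by simp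
  have "transpose_mat (c \<cdot>\<^sub>m 1\<^sub>m n :: real mat) = c \<cdot>\<^sub>m 1\<^sub>m n" by (intro eq_matI) auto
  then show "transpose_mat (c \<cdot>\<^sub>m 1\<^sub>m n + B) = c \<cdot>\<^sub>m 1\<^sub>m n + B"
    using B by (subst transpose_add[of _ n n]) auto
  assume v: "v \<in> carrier_vec n"
  have "(c \<cdot>\<^sub>m 1\<^sub>m n) *\<^sub>v v = c \<cdot>\<^sub>v v"
    using v by (intro eq_vecI) auto
  then show "v \<bullet> ((c \<cdot>\<^sub>m 1\<^sub>m n + B) *\<^sub>v v) = c * (v \<bullet> v) + v \<bullet> (B *\<^sub>v v)"
    using v B by (simp add: add_mult_distrib_mat_vec[of _ n n] scalar_prod_add_distrib[of _ n])
  then show "c * (v \<bullet> v) \<le> v \<bullet> ((c \<cdot>\<^sub>m 1\<^sub>m n + B) *\<^sub>v v)"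
    using assms v unfolding sym_psd_mat_def by simp
qed

lemma sym_psd_mat_congruence:
  assumes B: "sym_psd_mat n B" and G: "G \<in> carrier_mat n m"
  shows "sym_psd_mat m (transpose_mat G * B * G)"
proof -
  have c: "B \<in> carrier_mat n n" "transpose_mat B = B"
    using B unfolding sym_psd_mat_def by auto
  have "transpose_mat (transpose_mat G * B * G) = transpose_mat G * B * G"
    using c G by (simp add: transpose_mult[of _ m n _ m] transpose_mult[of _ n n _ m])
  moreover have "0 \<le> v \<bullet> ((transpose_mat G * B * G) *\<^sub>v v)" if "v \<in> carrier_vec m" for v
    unfolding scalar_prod_congruence[OF c(1) G that]
    using B G that unfolding sym_psd_mat_def by simp
  ultimately show ?thesis using c G unfolding sym_psd_mat_def by simp
qed

text \<open>Interchanging the factors of \<open>(P R) (R\<^sup>T P)\<close> and of \<open>R R\<^sup>T\<close>, where \<open>B = R R\<^sup>T\<close>, makes the two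
  sides comparable in the Loewner order: \<open>v \<bullet> R\<^sup>T P R v = Rv \<bullet> P R v \<le> Rv \<bullet> Rv\<close>.\<close>

lemma det_compression_le:
  assumes B: "sym_psd_mat n B" and P: "orth_proj_mat n P" and c: "0 < c"
  shows "det (c \<cdot>\<^sub>m 1\<^sub>m n + P * B * P) \<le> det (c \<cdot>\<^sub>m 1\<^sub>m n + B)"
proof -
  obtain R where R: "R \<in> carrier_mat n n" and BR: "B = R * transpose_mat R"
    using psd_mat_factorization[OF B] .
  have p: "P \<in> carrier_mat n n" "transpose_mat P = P" "P * P = P"
    using P unfolding orth_proj_mat_def by auto
  have Rt: "transpose_mat R \<in> carrier_mat n n" using R by simp
  have I: "sym_psd_mat n (1\<^sub>m n)"
    using real_scalar_prod_self_pos(1) unfolding sym_psd_mat_def by simp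
  have Ppsd: "sym_psd_mat n P"
    using p orth_proj_mat_scalar_prod(1)[OF P] unfolding sym_psd_mat_def by simp
  \<comment> \<open>Inserting the identity into \<open>R\<^sup>T R\<close> makes it a congruence as well, so that both matrices are
    covered by the same lemmas.\<close>
  let ?S = "transpose_mat R * P * R" and ?M = "transpose_mat R * 1\<^sub>m n * R"
  have S: "sym_psd_mat n ?S" and M: "sym_psd_mat n ?M"
    using sym_psd_mat_congruence[OF Ppsd R] sym_psd_mat_congruence[OF I R] by auto
  have "(P * R) * (transpose_mat R * P) = P * B * P"
    unfolding BR using R p by (simp add: assoc_mult_mat[of _ n n _ n _ n])
  moreover have "(transpose_mat R * P) * (P * R) = transpose_mat R * (P * P) * R"
    using R p(1) by (simp add: assoc_mult_mat[of _ n n _ n _ n])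
  ultimately have "det (c \<cdot>\<^sub>m 1\<^sub>m n + P * B * P) = det (c \<cdot>\<^sub>m 1\<^sub>m n + ?S)"
    using det_smult_one_add_mult_commute[of "P * R" n "transpose_mat R * P" c] R p c by simp
  also have "\<dots> \<le> det (c \<cdot>\<^sub>m 1\<^sub>m n + ?M)"
  proof (rule det_mono_positive_definite[where c = c])
    fix v :: "real vec" assume v: "v \<in> carrier_vec n"
    have "v \<bullet> (?S *\<^sub>v v) \<le> v \<bullet> (?M *\<^sub>v v)"
      unfolding scalar_prod_congruence[OF p(1) R v] scalar_prod_congruence[OF one_carrier_mat R v]
      using orth_proj_mat_scalar_prod(2)[OF P, of "R *\<^sub>v v"] R v by simp
    then show "v \<bullet> ((c \<cdot>\<^sub>m 1\<^sub>m n + ?S) *\<^sub>v v) \<le> v \<bullet> ((c \<cdot>\<^sub>m 1\<^sub>m n + ?M) *\<^sub>v v)"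
      unfolding shifted_psd_mat(3)[OF S v] shifted_psd_mat(3)[OF M v] by simp
  qed (use shifted_psd_mat[OF S] shifted_psd_mat[OF M] c in auto)
  also have "\<dots> = det (c \<cdot>\<^sub>m 1\<^sub>m n + B)"
    unfolding BR using det_smult_one_add_mult_commute[OF R Rt, of c] c R by simp
  finally show ?thesis .
qed

lemma trace_log_compression_le:
  assumes B: "sym_psd_mat n B" and P: "orth_proj_mat n P" and c: "0 < c"
  shows "mat_trace (mat_log (c \<cdot>\<^sub>m 1\<^sub>m n + P * B * P)) \<le> mat_trace (mat_log (c \<cdot>\<^sub>m 1\<^sub>m n + B))"
proof -
  have p: "P \<in> carrier_mat n n" "transpose_mat P = P"
    using P unfolding orth_proj_mat_def by auto
  have PBP: "sym_psd_mat n (P * B * P)"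
    using sym_psd_mat_congruence[OF B p(1)] p(2) by simp
  have "mat_trace (mat_log (c \<cdot>\<^sub>m 1\<^sub>m n + X)) = ln (det (c \<cdot>\<^sub>m 1\<^sub>m n + X))"
    and "0 < det (c \<cdot>\<^sub>m 1\<^sub>m n + X)" if X: "sym_psd_mat n X" for X
    using mat_trace_mat_log[OF shifted_psd_mat(1,2)[OF X] c] shifted_psd_mat(4)[OF X] by auto
  then show ?thesis
    using B PBP det_compression_le[OF assms] by simp
qed

section \<open>Nested Krylov spaces\<close>

text \<open>The number of columns becomes a variable \<open>r\<close> of its own, so that the dimensions of \<open>W\<close> no longer
  refer to \<open>W\<close> itself.\<close>

lemma orthonormal_basis_matE:
  assumes "orthonormal_basis_mat m W S"
  obtains r where "W \<in> carrier_mat m r" "transpose_mat W * W = 1\<^sub>m r"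
    "vspan m (set (cols W)) = S"
proof
  show "W \<in> carrier_mat m (dim_col W)" "vspan m (set (cols W)) = S"
    using assms unfolding orthonormal_basis_mat_def by blast+
  show "transpose_mat W * W = 1\<^sub>m (dim_col W)"
    using assms unfolding orthonormal_basis_mat_def by (intro eq_matI) auto
qed

lemma orth_proj_mat_orthonormal_basis:
  assumes "orthonormal_basis_mat m W S"
  shows "orth_proj_mat m (W * transpose_mat W)"
proof -
  obtain r where c: "W \<in> carrier_mat m r" and WW: "transpose_mat W * W = 1\<^sub>m r"
    using assms by (rule orthonormal_basis_matE)
  have Wt: "transpose_mat W \<in> carrier_mat r m" using c by simp
  have "(W * transpose_mat W) * (W * transpose_mat W) = W * ((transpose_mat W * W) * transpose_mat W)"
    using c Wt by (simp add: assoc_mult_mat[of _ m r _ m _ m] assoc_mult_mat[of _ r m _ r _ m])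
  then have "(W * transpose_mat W) * (W * transpose_mat W) = W * transpose_mat W"
    unfolding WW using Wt by simp
  then show ?thesis
    using c transpose_mult[OF c Wt] unfolding orth_proj_mat_def by simp
qed

text \<open>The fixed vectors of \<open>W W\<^sup>T\<close> form a subspace, which contains the columns of \<open>W\<close> because
  \<open>W\<^sup>T W = I\<close>, hence also their span.\<close>

lemma orthonormal_basis_proj_fixes:
  assumes W: "orthonormal_basis_mat m W S" and v: "v \<in> S"
  shows "(W * transpose_mat W) *\<^sub>v v = v"
proof -
  interpret vec_space "TYPE(real)" m .
  let ?P = "W * transpose_mat W"
  let ?N = "{v \<in> carrier_vec m. ?P *\<^sub>v v = v}"
  obtain r where c: "W \<in> carrier_mat m r" and WW: "transpose_mat W * W = 1\<^sub>m r"
    and S: "span (set (cols W)) = S"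
    using W by (rule orthonormal_basis_matE)
  have P: "?P \<in> carrier_mat m m" using c by simp
  have zero: "X *\<^sub>v 0\<^sub>v m = 0\<^sub>v m" if "X \<in> carrier_mat m m" for X :: "real mat"
    using that by (intro eq_vecI) auto
  have PW: "?P * W = W"
    using c WW by (simp add: assoc_mult_mat[of _ m r _ m _ r])
  have cols: "set (cols W) \<subseteq> ?N"
  proof
    fix u assume "u \<in> set (cols W)"
    then obtain i where i: "i < r" "u = col W i" using c by (auto simp: cols_def)
    have "?P *\<^sub>v u = col (?P * W) i"
      unfolding i(2) using col_mult2[OF P c i(1)] by simp
    then show "u \<in> ?N" using i c unfolding PW by auto
  qed
  have "submodule class_ring ?N V"
  proof
    show "?N \<subseteq> carrier V" by auto
    show "\<zero>\<^bsub>V\<^esub> \<in> ?N" using zero[OF P] by simp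
    show "u \<oplus>\<^bsub>V\<^esub> w \<in> ?N" if "u \<in> ?N" "w \<in> ?N" for u w
      using that mult_add_distrib_mat_vec[OF P, of u w] by simp
    show "a \<odot>\<^bsub>V\<^esub> u \<in> ?N" if "a \<in> carrier class_ring" "u \<in> ?N" for a u
      using that mult_mat_vec[OF P, of u a] by simp
  qed
  then have "span (set (cols W)) \<subseteq> ?N"
    using cols by (intro span_is_subset)
  then show ?thesis using v unfolding S by auto
qed

lemma orthonormal_basis_proj_mult_subspace:
  assumes W: "orthonormal_basis_mat m W S" and W': "orthonormal_basis_mat m W' S'"
    and sub: "S \<subseteq> S'"
  shows "(W' * transpose_mat W') * W = W"
proof -
  interpret vec_space "TYPE(real)" m .
  let ?P = "W' * transpose_mat W'"
  obtain r where c: "W \<in> carrier_mat m r" and S: "span (set (cols W)) = S"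
    using W by (rule orthonormal_basis_matE)
  have P: "?P \<in> carrier_mat m m"
    using orth_proj_mat_orthonormal_basis[OF W'] unfolding orth_proj_mat_def by simp
  have "set (cols W) \<subseteq> S"
    unfolding S[symmetric] using c cols_dim[of W] by (intro in_own_span) auto
  then have col: "?P *\<^sub>v col W i = col W i" if "i < r" for i
    using nth_mem[of i "cols W"] that sub c orthonormal_basis_proj_fixes[OF W', of "col W i"] by auto
  show ?thesis
  proof (rule mat_col_eqI)
    fix i assume "i < dim_col W"
    then have "i < r" using c by simp
    then show "col (?P * W) i = col W i" using col_mult2[OF P c] col by simp
  qed (use P c in auto)
qed

text \<open>Prepending \<open>y\<close> shifts column \<open>j\<close> to column \<open>Suc j\<close>, so each generator of the smaller
  Krylov space is also a generator of the larger one.\<close>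

lemma krylov_space_augment_col_mono:
  assumes A: "A \<in> carrier_mat m m" and y: "y \<in> carrier_vec m" and Z: "Z \<in> carrier_mat m n"
  shows "krylov_space k A Z \<subseteq> krylov_space k A (augment_col y Z)"
proof -
  interpret vec_space "TYPE(real)" m .
  let ?Z = "augment_col y Z"
  have Z': "?Z \<in> carrier_mat m (Suc n)"
    using y Z unfolding augment_col_def
    using mat_of_cols_carrier(1)[of m "y # cols Z"] by auto
  have col: "col ?Z (Suc j) = col Z j" if "j < n" for j
    using that y Z unfolding augment_col_def by (subst col_mat_of_cols) auto
  have "set (cols (A ^\<^sub>m i * Z)) \<subseteq> set (cols (A ^\<^sub>m i * ?Z))" for i
  proof
    fix u assume "u \<in> set (cols (A ^\<^sub>m i * Z))"
    then obtain j where j: "j < n" "u = col (A ^\<^sub>m i * Z) j" using Z by (auto simp: cols_def)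
    have Ai: "A ^\<^sub>m i \<in> carrier_mat m m" using A by simp
    have "u = col (A ^\<^sub>m i * ?Z) (Suc j)"
      unfolding j(2) col_mult2[OF Ai Z j(1)] using col_mult2[OF Ai Z', of "Suc j"] col j(1) by simp
    then show "u \<in> set (cols (A ^\<^sub>m i * ?Z))" 
      using nth_mem[of "Suc j" "cols (A ^\<^sub>m i * ?Z)"] j(1) Z' by simp
  qed
  then have "set (krylov_cols k A Z) \<subseteq> set (krylov_cols k A ?Z)"
    unfolding krylov_cols_def by fastforce
  then show ?thesis
    using Z Z' span_is_monotone unfolding krylov_space_def by auto
qed

theorem lemma6:
  fixes A Om W T W' T' :: "real mat" and y :: "real vec" and lam :: real and m n k :: nat
  assumes A: "sym_psd_mat m A"
    and lam: "lam > 0"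
    and y: "y \<in> carrier_vec m"
    and Om: "Om \<in> carrier_mat m n"
    and k: "k \<ge> 1"
    and km: "k * (n + 1) \<le> m"
    and indpt: "lin_indpt_family m (krylov_cols k A (augment_col y Om))"
    and W: "orthonormal_basis_mat m W (krylov_space k A Om)"
    and T: "T = transpose_mat W * A * W"
    and W': "orthonormal_basis_mat m W' (krylov_space k A (augment_col y Om))"
    and T': "T' = transpose_mat W' * A * W'"
  shows "mat_trace (mat_log (lam \<cdot>\<^sub>m 1\<^sub>m m + W * T * transpose_mat W))
           \<le> mat_trace (mat_log (lam \<cdot>\<^sub>m 1\<^sub>m m + W' * T' * transpose_mat W'))
       \<and> mat_trace (mat_log (lam \<cdot>\<^sub>m 1\<^sub>m m + W' * T' * transpose_mat W'))
           \<le> mat_trace (mat_log (lam \<cdot>\<^sub>m 1\<^sub>m m + A))"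
proof -
  let ?P = "W * transpose_mat W" and ?P' = "W' * transpose_mat W'"
  have a: "A \<in> carrier_mat m m" using A unfolding sym_psd_mat_def by simp
  obtain r where w: "W \<in> carrier_mat m r" using W by (rule orthonormal_basis_matE)
  obtain r' where w': "W' \<in> carrier_mat m r'" using W' by (rule orthonormal_basis_matE)
  have compress: "X * (transpose_mat X * A * X) * transpose_mat X
      = (X * transpose_mat X) * A * (X * transpose_mat X)" if X: "X \<in> carrier_mat m s" for X s
  proof -
    have Xt: "transpose_mat X \<in> carrier_mat s m" using X by simp
    show ?thesis using X Xt a by (simp add: assoc_mult_mat[of _ m s _ m _ m]
        assoc_mult_mat[of _ s m _ m _ m] assoc_mult_mat[of _ s m _ s _ m]
        assoc_mult_mat[of _ m m _ s _ m] assoc_mult_mat[of _ m s _ s _ m])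
  qed
  \<comment> \<open>The Krylov spaces are nested, so the projection onto the larger one fixes the columns of \<open>W\<close>;
    transposing gives the product in the other order.\<close>
  have P: "orth_proj_mat m ?P" and P': "orth_proj_mat m ?P'"
    using orth_proj_mat_orthonormal_basis W W' by auto
  have p: "?P \<in> carrier_mat m m" "transpose_mat ?P = ?P"
    and p': "?P' \<in> carrier_mat m m" "transpose_mat ?P' = ?P'"
    using P P' unfolding orth_proj_mat_def by auto
  have "?P' * W = W"
    using orthonormal_basis_proj_mult_subspace[OF W W' krylov_space_augment_col_mono[OF a y Om]] .
  then have P'P: "?P' * ?P = ?P"
    using w p' assoc_mult_mat[of ?P' m m W r "transpose_mat W" m] by simp
  then have PP': "?P * ?P' = ?P"
    using transpose_mult[OF p'(1) p(1)] p p' by simp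
  let ?B = "?P' * A * ?P'"
  have B: "sym_psd_mat m ?B"
    using sym_psd_mat_congruence[OF A p'(1)] p'(2) by simp
  have "?P * ?B * ?P = (?P * ?P') * A * (?P' * ?P)"
    using p(1) p'(1) a
    by (simp only: assoc_mult_mat[of _ m m _ m _ m] mult_carrier_mat[of _ m m _ m])
  then have "?P * ?B * ?P = ?P * A * ?P" unfolding P'P PP' .
  then have "mat_trace (mat_log (lam \<cdot>\<^sub>m 1\<^sub>m m + ?P * A * ?P))
      \<le> mat_trace (mat_log (lam \<cdot>\<^sub>m 1\<^sub>m m + ?B))"
    using trace_log_compression_le[OF B P lam] by simp
  moreover have "mat_trace (mat_log (lam \<cdot>\<^sub>m 1\<^sub>m m + ?B)) \<le> mat_trace (mat_log (lam \<cdot>\<^sub>m 1\<^sub>m m + A))"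
    using trace_log_compression_le[OF A P' lam] .
  ultimately show ?thesis
    unfolding T T' compress[OF w] compress[OF w'] by blast
qed

end
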